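(* For all positive integers $n$, $m$ and $s$, $$N(U(n),m,s)=\binom{n-1}{s-1}\binom{m}{s}=\frac{s}{n}\binom{n}{s}\binom{m}{s}.$$
   Context: $U(n)$ is the group of $n\times n$ complex unitary matrices. For a unitary group $G$ and positive integers $m,s$, $N(G,m,s)$ denotes the number of conjugacy classes of $G$ (under conjugation by elements of $G$) consisting of elements $x\in G$ with $x^m=1$ and such that $x$ has exactly $s$ distinct eigenvalues. *)

theory Defs
  imports
    "HOL-Algebra.Group_Action"
    "Jordan_Normal_Form.Schur_Decomposition"
    "Jordan_Normal_Form.Spectral_Radius"
begin

definition unitary_group :: "nat \<Rightarrow> complex mat monoid" where
  "unitary_group n =
    \<lparr>carrier = {A \<in> carrier_mat n n. A * mat_adjoint A = 1\<^sub>m n \<and> mat_adjoint A * A = 1\<^sub>m n},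
     monoid.mult = (*),
     one = 1\<^sub>m n\<rparr>"

(* The action is cut off outside the carrier, as in group.action_by_conjugation. *)
definition conjugacy_classes :: "('a, 'b) monoid_scheme \<Rightarrow> 'a set set" where
  "conjugacy_classes G =
    orbits G (carrier G) (\<lambda>g. \<lambda>h \<in> carrier G. g \<otimes>\<^bsub>G\<^esub> h \<otimes>\<^bsub>G\<^esub> inv\<^bsub>G\<^esub> g)"

definition torsion_classes :: "complex mat monoid \<Rightarrow> nat \<Rightarrow> nat \<Rightarrow> complex mat set set" where
  "torsion_classes G m s =
    {C \<in> conjugacy_classes G. \<forall>x\<in>C. x [^]\<^bsub>G\<^esub> m = \<one>\<^bsub>G\<^esub> \<and> card (spectrum x) = s}"

(* Meaningful as a count only when torsion_classes G m s is finite, since card is 0 on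
   infinite sets. *)
definition N :: "complex mat monoid \<Rightarrow> nat \<Rightarrow> nat \<Rightarrow> nat" where
  "N G m s = card (torsion_classes G m s)"

lemma mat_adjoint_carrier:
  assumes "A \<in> carrier_mat n k"
  shows "mat_adjoint A \<in> carrier_mat k n"
  using assms unfolding mat_adjoint_def by (metis carrier_matD cols_length length_map mat_of_rows_carrier(1))

lemma mat_adjoint_index:
  assumes "i < dim_col A" "j < dim_row A"
  shows "mat_adjoint A $$ (i, j) = conjugate (A $$ (j, i))"
  using assms by (simp add: mat_adjoint_def mat_of_rows_index)

lemma mat_adjoint_adjoint:
  fixes A :: "complex mat"
  shows "mat_adjoint (mat_adjoint A) = A"
proof -
  have d: "mat_adjoint A \<in> carrier_mat (dim_col A) (dim_row A)"
    by (rule mat_adjoint_carrier) auto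
  have d2: "mat_adjoint (mat_adjoint A) \<in> carrier_mat (dim_row A) (dim_col A)"
    by (rule mat_adjoint_carrier[OF d])
  show ?thesis
    by (rule eq_matI) (use d d2 in \<open>auto simp: mat_adjoint_index\<close>)
qed

lemma mat_adjoint_mult:
  fixes A B :: "complex mat"
  assumes A: "A \<in> carrier_mat n k" and B: "B \<in> carrier_mat k l"
  shows "mat_adjoint (A * B) = mat_adjoint B * mat_adjoint A"
proof -
  have c: "mat_adjoint A \<in> carrier_mat k n" "mat_adjoint B \<in> carrier_mat l k"
    "mat_adjoint (A * B) \<in> carrier_mat l n"
    using A B by (auto intro: mat_adjoint_carrier)
  show ?thesis
  proof (rule eq_matI)
    fix i j assume "i < dim_row (mat_adjoint B * mat_adjoint A)"
      and "j < dim_col (mat_adjoint B * mat_adjoint A)"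
    then have ij: "i < l" "j < n" using c by auto
    then show "mat_adjoint (A * B) $$ (i, j) = (mat_adjoint B * mat_adjoint A) $$ (i, j)"
      using A B c by (auto simp: mat_adjoint_index scalar_prod_def mult.commute intro!: sum.cong)
  qed (use c in auto)
qed

lemma mat_adjoint_one: "mat_adjoint (1\<^sub>m n :: complex mat) = 1\<^sub>m n"
  by (rule eq_matI) (auto simp: mat_adjoint_index mat_adjoint_def mat_of_rows_def)

lemma group_unitary_group: "group (unitary_group n)"
proof (rule groupI)
  fix A B assume "A \<in> carrier (unitary_group n)" "B \<in> carrier (unitary_group n)"
  then have A: "A \<in> carrier_mat n n" "A * mat_adjoint A = 1\<^sub>m n" "mat_adjoint A * A = 1\<^sub>m n"
    and B: "B \<in> carrier_mat n n" "B * mat_adjoint B = 1\<^sub>m n" "mat_adjoint B * B = 1\<^sub>m n"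
    by (auto simp: unitary_group_def)
  note a = mat_adjoint_carrier[OF A(1)] and b = mat_adjoint_carrier[OF B(1)]
  have "A * B * (mat_adjoint B * mat_adjoint A) = A * (B * mat_adjoint B) * mat_adjoint A"
    using A(1) B(1) a b by (simp add: assoc_mult_mat[of _ n n _ n _ n])
  moreover have "mat_adjoint B * mat_adjoint A * (A * B) = mat_adjoint B * (mat_adjoint A * A) * B"
    using A(1) B(1) a b by (simp add: assoc_mult_mat[of _ n n _ n _ n])
  ultimately show "A \<otimes>\<^bsub>unitary_group n\<^esub> B \<in> carrier (unitary_group n)"
    using A B b by (simp add: unitary_group_def mat_adjoint_mult)
next
  fix A assume "A \<in> carrier (unitary_group n)"
  then show "\<exists>B\<in>carrier (unitary_group n). B \<otimes>\<^bsub>unitary_group n\<^esub> A = \<one>\<^bsub>unitary_group n\<^esub>"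
    by (intro bexI[of _ "mat_adjoint A"])
      (auto simp: unitary_group_def mat_adjoint_adjoint intro: mat_adjoint_carrier)
qed (auto simp: unitary_group_def mat_adjoint_one)

lemma inv_unitary_group:
  assumes "A \<in> carrier (unitary_group n)"
  shows "inv\<^bsub>unitary_group n\<^esub> A = mat_adjoint A"
proof -
  interpret group "unitary_group n" by (rule group_unitary_group)
  show ?thesis
    using assms
    by (intro inv_equality)
      (auto simp: unitary_group_def mat_adjoint_adjoint intro: mat_adjoint_carrier)
qed

lemma pow_unitary_group: "A [^]\<^bsub>unitary_group n\<^esub> (k :: nat) = A ^\<^sub>m k"
  if "A \<in> carrier (unitary_group n)"
proof -
  have "A \<in> carrier_mat n n" using that by (simp add: unitary_group_def)
  then show ?thesis by (induction k) (auto simp: nat_pow_def unitary_group_def)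
qed

end

(* By the spectral theorem, two unitary matrices are conjugate in U(n) exactly when they have the
   same multiset of eigenvalues, and every n-element multiset of numbers of modulus 1 occurs. A unitary
   matrix satisfies x^m = 1 iff all its eigenvalues are m-th roots of unity, so the classes
   correspond to multisets of size n whose support is an s-element subset of the m roots of
   unity; for each such support, Pascal's rule gives (n-1 choose s-1) multisets. *)
theory Submission
  imports Defs
begin

section \<open>Membership in the unitary group and conjugation by unitary matrices\<close>

text \<open>A one-sided inverse of a square matrix over a field is two-sided.\<close>

lemma mem_unitary_group_iff:
  "A \<in> carrier (unitary_group n) \<longleftrightarrow> A \<in> carrier_mat n n \<and> mat_adjoint A * A = 1\<^sub>m n"
  using mat_mult_left_right_inverse[OF mat_adjoint_carrier]
  by (auto simp: unitary_group_def)

lemma unitary_groupD: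
  assumes "A \<in> carrier (unitary_group n)"
  shows "A \<in> carrier_mat n n" "mat_adjoint A \<in> carrier_mat n n"
    "mat_adjoint A * A = 1\<^sub>m n" "A * mat_adjoint A = 1\<^sub>m n"
  using assms by (auto simp: unitary_group_def intro: mat_adjoint_carrier)

lemma mat_adjoint_unitary_group:
  assumes "A \<in> carrier (unitary_group n)"
  shows "mat_adjoint A \<in> carrier (unitary_group n)"
  using unitary_groupD[OF assms] by (simp add: mem_unitary_group_iff mat_adjoint_adjoint)

lemma mult_unitary_group:
  assumes "A \<in> carrier (unitary_group n)" "B \<in> carrier (unitary_group n)"
  shows "A * B \<in> carrier (unitary_group n)"
proof -
  interpret group "unitary_group n" by (rule group_unitary_group)
  show ?thesis using m_closed[OF assms] by (simp add: unitary_group_def)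
qed

lemma similar_mat_wit_unitary:
  assumes "W \<in> carrier (unitary_group n)" "B \<in> carrier_mat n n"
  shows "similar_mat_wit (W * B * mat_adjoint W) B W (mat_adjoint W)"
  using unitary_groupD[OF assms(1)] assms(2)
  by (intro similar_mat_witI[where n = n]) (auto intro: mult_carrier_mat)

lemma char_poly_unitary_conj:
  assumes "W \<in> carrier (unitary_group n)" "B \<in> carrier_mat n n"
  shows "char_poly (W * B * mat_adjoint W) = char_poly B"
  using similar_mat_wit_unitary[OF assms] by (intro char_poly_similar) (auto simp: similar_mat_def)

lemma unitary_conj_conj:
  fixes V W B :: "complex mat"
  assumes "V \<in> carrier_mat n n" "W \<in> carrier_mat n n" "B \<in> carrier_mat n n"
  shows "V * (W * B * mat_adjoint W) * mat_adjoint V = (V * W) * B * mat_adjoint (V * W)"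
  using assms mat_adjoint_carrier[OF assms(1)] mat_adjoint_carrier[OF assms(2)]
  by (simp add: mat_adjoint_mult[OF assms(1,2)] assoc_mult_mat[of _ n n _ n _ n])

lemma unitary_conj_inverse:
  assumes W: "W \<in> carrier (unitary_group n)" and A: "A \<in> carrier_mat n n"
  shows "W * (mat_adjoint W * A * W) * mat_adjoint W = A"
    "mat_adjoint W * (W * A * mat_adjoint W) * W = A"
  using unitary_groupD[OF W] unitary_conj_conj[of W n "mat_adjoint W" A]
    unitary_conj_conj[of "mat_adjoint W" n W A] A
  by (simp_all add: mat_adjoint_adjoint mat_adjoint_one)

section \<open>Gram matrices and unitary matrices with a prescribed first column\<close>

lemma mat_adjoint_mult_self_index:
  fixes A :: "complex mat"
  assumes "A \<in> carrier_mat n n" "i < n" "j < n"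
  shows "(mat_adjoint A * A) $$ (i, j) = (\<Sum>k<n. cnj (A $$ (k, i)) * A $$ (k, j))"
  using assms mat_adjoint_carrier[OF assms(1)]
  by (auto simp: scalar_prod_def mat_adjoint_index atLeast0LessThan intro!: sum.cong)

text \<open>Complete \<open>v\<close> to a basis, apply Gram-Schmidt, which keeps the first vector,
  and normalise; the resulting vectors are the columns of \<open>W\<close>.\<close>

lemma ex_unitary_first_col:
  fixes v :: "complex vec"
  assumes v: "v \<in> carrier_vec n" and v0: "v \<noteq> 0\<^sub>v n"
  shows "\<exists>W\<in>carrier (unitary_group n). \<exists>c. c \<noteq> 0 \<and> col W 0 = c \<cdot>\<^sub>v v"
proof -
  interpret cof_vec_space n "TYPE(complex)" .
  define b where "b = basis_completion v"
  define ws where "ws = gram_schmidt n b"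
  have n: "n > 0" using v v0 by (cases n) auto
  from basis_completion[OF v v0, folded b_def]
  have dist_b: "distinct b" and indep: "\<not> lin_dep (set b)" and b: "set b \<subseteq> carrier_vec n"
    and hdb: "hd b = v" and len_b: "length b = n" by auto
  from hdb len_b n obtain vs where bv: "b = v # vs" by (cases b) auto
  from gram_schmidt_result[OF b dist_b indep refl, folded ws_def]
  have ws: "set ws \<subseteq> carrier_vec n" "corthogonal ws" "length ws = n"
    by (auto simp: len_b)
  from gram_schmidt_hd[OF v, of vs, folded bv] have "hd ws = v" unfolding ws_def .
  then have ws0: "ws ! 0 = v" using ws(3) n by (cases ws) auto
  \<comment> \<open>The Gram-Schmidt vectors are orthogonal but not normalised: \<open>r i\<close>
    is the squared length of the i-th one, and the real factor \<open>c i\<close> scales it to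
    length 1.\<close>
  define r where "r i = (\<Sum>k<n. (cmod (ws ! i $ k))\<^sup>2)" for i
  define c where "c i = complex_of_real (1 / sqrt (r i))" for i
  define W where "W = Matrix.mat n n (\<lambda>(i, j). c j * ws ! j $ i)"
  have wsi: "ws ! i \<in> carrier_vec n" if "i < n" for i using ws that by auto
  have ip: "ws ! i \<bullet>c ws ! j = (\<Sum>k<n. ws ! i $ k * cnj (ws ! j $ k))" if "i < n" "j < n" for i j
    using wsi[OF that(1)] wsi[OF that(2)]
    by (auto simp: scalar_prod_def atLeast0LessThan intro!: sum.cong)
  \<comment> \<open>The case \<open>i = j\<close> matters as well: \<open>corthogonal\<close>
    excludes zero vectors, which makes every \<open>r i\<close> non-zero.\<close>
  have orth: "(\<Sum>k<n. ws ! i $ k * cnj (ws ! j $ k)) = 0 \<longleftrightarrow> i \<noteq> j" if "i < n" "j < n" for i j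
    using corthogonalD[OF ws(2), of i j] that ws(3) ip[OF that] by simp
  have norm: "(\<Sum>k<n. ws ! i $ k * cnj (ws ! i $ k)) = of_real (r i)" for i
    unfolding r_def of_real_sum complex_norm_square ..
  have r: "r i > 0" if "i < n" for i
  proof -
    have "r i \<noteq> 0" using orth[OF that that] norm[of i] by auto
    moreover have "r i \<ge> 0" unfolding r_def by (intro sum_nonneg) auto
    ultimately show ?thesis by simp
  qed
  have c2: "c i * c i * of_real (r i) = 1" if "i < n" for i
    using r[OF that] unfolding c_def of_real_mult[symmetric] by simp
  have W: "W \<in> carrier_mat n n" by (simp add: W_def)
  have "mat_adjoint W * W = 1\<^sub>m n"
  proof (rule eq_matI)
    fix i j assume "i < dim_row (1\<^sub>m n :: complex mat)" "j < dim_col (1\<^sub>m n :: complex mat)"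
    then have ij: "i < n" "j < n" by auto
    have "(mat_adjoint W * W) $$ (i, j) = (\<Sum>k<n. cnj (W $$ (k, i)) * W $$ (k, j))"
      using mat_adjoint_mult_self_index[OF W ij] .
    also have "\<dots> = (\<Sum>k<n. c i * c j * (ws ! j $ k * cnj (ws ! i $ k)))"
      by (rule sum.cong) (use ij in \<open>auto simp: W_def c_def\<close>)
    also have "\<dots> = c i * c j * (\<Sum>k<n. ws ! j $ k * cnj (ws ! i $ k))"
      by (simp add: sum_distrib_left)
    also have "\<dots> = 1\<^sub>m n $$ (i, j)"
      using ij orth[of j i] norm[of i] c2[of i] by (cases "i = j") auto
    finally show "(mat_adjoint W * W) $$ (i, j) = 1\<^sub>m n $$ (i, j)" .
  qed (use W mat_adjoint_carrier[OF W] in auto)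
  with W have WU: "W \<in> carrier (unitary_group n)" by (simp add: mem_unitary_group_iff)
  have col: "col W 0 = c 0 \<cdot>\<^sub>v v"
    using n v ws0 by (intro eq_vecI) (auto simp: W_def)
  have "c 0 \<noteq> 0" using c2[OF n] by auto
  with col WU show ?thesis by blast
qed

section \<open>Block diagonal unitary matrices\<close>

lemma mat_adjoint_four_block_mat_diag:
  fixes B C :: "complex mat"
  assumes B: "B \<in> carrier_mat k k" and C: "C \<in> carrier_mat l l"
  shows "mat_adjoint (four_block_mat B (0\<^sub>m k l) (0\<^sub>m l k) C) =
    four_block_mat (mat_adjoint B) (0\<^sub>m k l) (0\<^sub>m l k) (mat_adjoint C)"
proof -
  have F: "four_block_mat B (0\<^sub>m k l) (0\<^sub>m l k) C \<in> carrier_mat (k + l) (k + l)"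
    using B C by auto
  show ?thesis
    using B C mat_adjoint_carrier[OF B] mat_adjoint_carrier[OF C] mat_adjoint_carrier[OF F]
    by (intro eq_matI) (auto simp: mat_adjoint_index)
qed

lemma four_block_mat_diag_mult:
  fixes B C :: "complex mat"
  assumes "B \<in> carrier_mat k k" "C \<in> carrier_mat l l" "B' \<in> carrier_mat k k" "C' \<in> carrier_mat l l"
  shows "four_block_mat B (0\<^sub>m k l) (0\<^sub>m l k) C * four_block_mat B' (0\<^sub>m k l) (0\<^sub>m l k) C' =
    four_block_mat (B * B') (0\<^sub>m k l) (0\<^sub>m l k) (C * C')"
  using assms by (subst mult_four_block_mat[of _ k k _ l _ l _ _ k _ l]) auto

lemma four_block_mat_diag_eq_one_iff:
  assumes B: "B \<in> carrier_mat k k" and C: "C \<in> carrier_mat l l"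
  shows "four_block_mat B (0\<^sub>m k l) (0\<^sub>m l k) C = 1\<^sub>m (k + l) \<longleftrightarrow> B = 1\<^sub>m k \<and> C = 1\<^sub>m l"
    (is "?F = _ \<longleftrightarrow> _")
proof
  assume eq: "?F = 1\<^sub>m (k + l)"
  have "B $$ (i, j) = 1\<^sub>m k $$ (i, j)" if "i < k" "j < k" for i j
    using arg_cong[OF eq, of "\<lambda>M. M $$ (i, j)"] that B C by simp
  moreover have "C $$ (i, j) = 1\<^sub>m l $$ (i, j)" if "i < l" "j < l" for i j
    using arg_cong[OF eq, of "\<lambda>M. M $$ (k + i, k + j)"] that B C by simp
  ultimately show "B = 1\<^sub>m k \<and> C = 1\<^sub>m l" using B C by auto
qed simp

text \<open>Both directions serve the spectral theorem: one passes from a matrix to its lower right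
  block, the other extends a unitary matrix of the smaller size.\<close>

lemma four_block_mat_diag_unitary_iff:
  assumes B: "B \<in> carrier_mat k k" and C: "C \<in> carrier_mat l l"
  shows "four_block_mat B (0\<^sub>m k l) (0\<^sub>m l k) C \<in> carrier (unitary_group (k + l)) \<longleftrightarrow>
    B \<in> carrier (unitary_group k) \<and> C \<in> carrier (unitary_group l)"
proof -
  note B' = mat_adjoint_carrier[OF B] and C' = mat_adjoint_carrier[OF C]
  show ?thesis
    using B C B' C' four_block_mat_diag_eq_one_iff[of "mat_adjoint B * B" k "mat_adjoint C * C" l]
    by (simp add: mem_unitary_group_iff mat_adjoint_four_block_mat_diag four_block_mat_diag_mult)
qed

text \<open>The first row has norm 1 and its first entry already has modulus 1.\<close>
lemma unitary_first_row_zero: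
  assumes A: "A \<in> carrier (unitary_group n)"
    and col: "\<And>i. 0 < i \<Longrightarrow> i < n \<Longrightarrow> A $$ (i, 0) = 0"
    and j: "0 < j" "j < n"
  shows "A $$ (0, j) = 0"
proof -
  note Ad = unitary_groupD[OF A]
  have n: "0 < n" using j by simp
  \<comment> \<open>Column 0 has norm 1 and only its top entry can be non-zero, so that entry has
    modulus 1.\<close>
  have "1 = (\<Sum>k<n. cnj (A $$ (k, 0)) * A $$ (k, 0))"
    using mat_adjoint_mult_self_index[OF Ad(1) n n] Ad(3) n by simp
  also have "\<dots> = (\<Sum>k\<in>{0}. cnj (A $$ (k, 0)) * A $$ (k, 0))"
    by (rule sum.mono_neutral_right) (use n col in auto)
  finally have "complex_of_real ((cmod (A $$ (0, 0)))\<^sup>2) = 1"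
    by (simp add: complex_norm_square mult.commute del: of_real_power)
  then have e: "(cmod (A $$ (0, 0)))\<^sup>2 = 1"
    using of_real_eq_1_iff by blast
  \<comment> \<open>The column formula applied to \<open>mat_adjoint A\<close> reads off the norm of
    row 0 of \<open>A\<close>.\<close>
  have "1 = (\<Sum>k<n. cnj (mat_adjoint A $$ (k, 0)) * mat_adjoint A $$ (k, 0))"
    using mat_adjoint_mult_self_index[OF Ad(2) n n] Ad(4) n by (simp add: mat_adjoint_adjoint)
  also have "\<dots> = (\<Sum>k<n. complex_of_real ((cmod (A $$ (0, k)))\<^sup>2))"
    by (rule sum.cong) (use Ad(1) n in \<open>auto simp: mat_adjoint_index complex_norm_square simp del: of_real_power\<close>)
  finally have "complex_of_real (\<Sum>k<n. (cmod (A $$ (0, k)))\<^sup>2) = 1" by simp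
  then have "(\<Sum>k<n. (cmod (A $$ (0, k)))\<^sup>2) = 1" using of_real_eq_1_iff by blast
  moreover have "(\<Sum>k<n. (cmod (A $$ (0, k)))\<^sup>2) =
      (cmod (A $$ (0, 0)))\<^sup>2 + (\<Sum>k\<in>{..<n} - {0}. (cmod (A $$ (0, k)))\<^sup>2)"
    by (rule sum.remove) (use n in auto)
  ultimately have "(\<Sum>k\<in>{..<n} - {0}. (cmod (A $$ (0, k)))\<^sup>2) = 0" using e by simp
  then have "\<forall>k\<in>{..<n} - {0}. (cmod (A $$ (0, k)))\<^sup>2 = 0"
    by (subst (asm) sum_nonneg_eq_0_iff) auto
  then show ?thesis using j by auto
qed

section \<open>The spectral theorem for unitary matrices\<close>

lemma mat_diag_Cons:
  "mat_diag (Suc (length es)) ((!) (e # es)) =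
    four_block_mat (mat_diag 1 (\<lambda>_. e)) (0\<^sub>m 1 (length es)) (0\<^sub>m (length es) 1)
      (mat_diag (length es) ((!) es))"
  by (rule eq_matI) (auto simp: mat_diag_def nth_Cons' less_Suc_eq_0_disj)

text \<open>Deflation by induction on \<open>es\<close>: conjugating by a unitary matrix whose first
  column is an eigenvector for \<open>e\<close> clears the first column below \<open>e\<close>;
  unitarity then clears the rest of the first row, and the remaining block is unitary with
  eigenvalues \<open>es\<close>. The diagonal follows the order of the given list, so matrices with
  equal characteristic polynomials reach the same diagonal matrix.\<close>

lemma unitary_spectral:
  assumes "A \<in> carrier (unitary_group n)"
    and "char_poly A = (\<Prod>e\<leftarrow>es. [:- e, 1:])"
  shows "\<exists>W\<in>carrier (unitary_group n). A = W * mat_diag n ((!) es) * mat_adjoint W"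
  using assms
proof (induction es arbitrary: n A)
  case Nil
  have A: "A \<in> carrier_mat n n" using unitary_groupD[OF Nil(1)] by simp
  from Nil degree_monic_char_poly[OF A] have "n = 0" by simp
  with A show ?case
    by (intro bexI[of _ "1\<^sub>m 0"]) (auto simp: mem_unitary_group_iff mat_adjoint_one)
next
  case (Cons e es)
  note Ad = unitary_groupD[OF Cons.prems(1)]
  have "degree (char_poly A) = Suc (length es)"
    unfolding Cons.prems(2) using degree_linear_factors[of uminus "e # es"] by simp
  with degree_monic_char_poly[OF Ad(1)] have n: "n = Suc (length es)" by simp
  define k where "k = length es"
  have nk: "n = 1 + k" by (simp add: n k_def)
  have "eigenvalue A e"
    unfolding eigenvalue_root_char_poly[OF Ad(1)] Cons.prems(2) by simp
  then obtain v where v: "v \<in> carrier_vec n" "v \<noteq> 0\<^sub>v n" "A *\<^sub>v v = e \<cdot>\<^sub>v v"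
    using Ad(1) unfolding eigenvalue_def eigenvector_def by auto
  from ex_unitary_first_col[OF v(1,2)] obtain W c
    where W: "W \<in> carrier (unitary_group n)" and c: "c \<noteq> 0" "col W 0 = c \<cdot>\<^sub>v v" by blast
  note Wd = unitary_groupD[OF W]
  define A' where "A' = mat_adjoint W * A * W"
  have A'U: "A' \<in> carrier (unitary_group n)"
    unfolding A'_def using W Cons.prems(1) by (intro mult_unitary_group mat_adjoint_unitary_group)
  note A'd = unitary_groupD[OF A'U]
  have AA': "A = W * A' * mat_adjoint W"
    unfolding A'_def using unitary_conj_inverse(1)[OF W Ad(1)] by simp
  \<comment> \<open>\<open>col W 0\<close> is an eigenvector of \<open>A\<close> for
    \<open>e\<close>, and \<open>mat_adjoint W\<close> sends it to the first unit vector; hence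
    column 0 of \<open>A'\<close> is \<open>e\<close> times that unit vector.\<close>
  have "col A' 0 = col (mat_adjoint W * (A * W)) 0"
    unfolding A'_def using Ad(1) Wd(1,2) by (simp only: assoc_mult_mat[of _ n n _ n _ n])
  also have "\<dots> = mat_adjoint W *\<^sub>v col (A * W) 0"
    using Ad(1) Wd(1,2) n by (intro col_mult2) auto
  also have "col (A * W) 0 = A *\<^sub>v col W 0"
    using Ad(1) Wd(1) n by (intro col_mult2) auto
  also have "A *\<^sub>v col W 0 = e \<cdot>\<^sub>v col W 0"
    unfolding c(2) using Ad(1) v by (simp add: mult_mat_vec smult_smult_assoc mult.commute)
  also have "mat_adjoint W *\<^sub>v (e \<cdot>\<^sub>v col W 0) = e \<cdot>\<^sub>v (mat_adjoint W *\<^sub>v col W 0)"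
    using Wd(1,2) by (intro mult_mat_vec) auto
  also have "mat_adjoint W *\<^sub>v col W 0 = col (mat_adjoint W * W) 0"
    using Wd(1,2) n by (subst col_mult2[of _ n n _ n]) auto
  finally have col: "col A' 0 = e \<cdot>\<^sub>v col (1\<^sub>m n) 0" unfolding Wd(3) .
  have ent: "A' $$ (i, 0) = (if i = 0 then e else 0)" if "i < n" for i
    using arg_cong[OF col, of "\<lambda>x. x $ i"] that A'd(1) n by auto
  have row: "A' $$ (0, j) = 0" if "0 < j" "j < n" for j
    using unitary_first_row_zero[OF A'U _ that] ent by auto
  define A3 where "A3 = Matrix.mat k k (\<lambda>(i, j). A' $$ (Suc i, Suc j))"
  have A3: "A3 \<in> carrier_mat k k" by (simp add: A3_def)
  have E: "mat_diag 1 (\<lambda>_. e) \<in> carrier_mat 1 1" by simp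
  have blk: "A' = four_block_mat (mat_diag 1 (\<lambda>_. e)) (0\<^sub>m 1 k) (0\<^sub>m k 1) A3"
    using A'd(1) ent row
    by (intro eq_matI) (auto simp: A3_def mat_diag_def nk)
  from A'U have A3U: "A3 \<in> carrier (unitary_group k)"
    unfolding blk nk four_block_mat_diag_unitary_iff[OF E A3] by simp
  \<comment> \<open>The block form factors the characteristic polynomial; cancelling the non-zero
    factor for \<open>e\<close> gives the premise of the induction hypothesis for
    \<open>A3\<close>.\<close>
  have "[:- e, 1:] * (\<Prod>e\<leftarrow>es. [:- e, 1:]) = char_poly A'"
    using Cons.prems(2) char_poly_unitary_conj[OF W A'd(1)] AA' by simp
  also have "\<dots> = char_poly (mat_diag 1 (\<lambda>_. e)) * char_poly A3"
    unfolding blk by (rule char_poly_four_block_zeros_col[OF E _ A3]) simp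
  also have "char_poly (mat_diag 1 (\<lambda>_. e)) = [:- e, 1:]"
    by (subst char_poly_upper_triangular[OF E]) (auto simp: mat_diag_def diag_mat_def)
  finally have "char_poly A3 = (\<Prod>e\<leftarrow>es. [:- e, 1:])"
    by (metis mult_cancel_left pCons_eq_0_iff zero_neq_one)
  from Cons.IH[OF A3U this] obtain P where P: "P \<in> carrier (unitary_group k)"
    and A3P: "A3 = P * mat_diag k ((!) es) * mat_adjoint P" by blast
  note Pd = unitary_groupD[OF P]
  \<comment> \<open>Extending \<open>P\<close> by 1 in the corner leaves the entry \<open>e\<close>
    untouched while diagonalising the block \<open>A3\<close>.\<close>
  define Q where "Q = four_block_mat (1\<^sub>m 1) (0\<^sub>m 1 k) (0\<^sub>m k 1) P"
  have "1\<^sub>m 1 \<in> carrier (unitary_group 1)" by (simp add: mem_unitary_group_iff mat_adjoint_one)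
  with P have Q: "Q \<in> carrier (unitary_group n)"
    unfolding Q_def nk using four_block_mat_diag_unitary_iff[OF _ Pd(1), of "1\<^sub>m 1" 1] by simp
  have "Q * mat_diag n ((!) (e # es)) * mat_adjoint Q = A'"
    unfolding n mat_diag_Cons unfolding k_def[symmetric] Q_def blk A3P
    using Pd left_mult_one_mat[OF E] right_mult_one_mat[OF E]
    by (simp add: mat_adjoint_four_block_mat_diag mat_adjoint_one
      four_block_mat_diag_mult[of _ 1 _ k] mult_carrier_mat[of _ k k] del: One_nat_def)
  with AA' have "A = (W * Q) * mat_diag n ((!) (e # es)) * mat_adjoint (W * Q)"
    using unitary_conj_conj[OF Wd(1) unitary_groupD(1)[OF Q] mat_diag_dim] by metis
  with mult_unitary_group[OF W Q] show ?case by blast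
qed

section \<open>Diagonal matrices, eigenvalue multisets and conjugacy\<close>

lemma mat_adjoint_mat_diag:
  "mat_adjoint (mat_diag n f :: complex mat) = mat_diag n (\<lambda>i. cnj (f i))"
  using mat_adjoint_carrier[OF mat_diag_dim[of n f]]
  by (intro eq_matI) (auto simp: mat_adjoint_index mat_diag_def)

lemma mat_diag_unitary_group:
  assumes "\<And>i. i < n \<Longrightarrow> cmod (f i) = 1"
  shows "mat_diag n f \<in> carrier (unitary_group n)"
proof -
  have "mat_diag n (\<lambda>i. cnj (f i) * f i) = mat_diag n (\<lambda>_. 1)"
    by (rule eq_matI) (use assms in \<open>auto simp: mat_diag_def complex_norm_square[symmetric] mult.commute\<close>)
  then show ?thesis by (simp add: mem_unitary_group_iff mat_adjoint_mat_diag)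
qed

lemma char_poly_mat_diag:
  "char_poly (mat_diag (length es) ((!) es)) = (\<Prod>e\<leftarrow>es. [:- e, 1:])"
proof -
  have "diag_mat (mat_diag (length es) ((!) es)) = es"
    by (rule nth_equalityI) (auto simp: diag_mat_def mat_diag_def)
  then show ?thesis
    by (subst char_poly_upper_triangular[OF mat_diag_dim]) (auto simp: mat_diag_def)
qed

lemma proots_linear_factors:
  fixes es :: "'a::idom list"
  shows "proots (\<Prod>e\<leftarrow>es. [:- e, 1:]) = mset es"
proof (induction es)
  case (Cons e es)
  have "(\<Prod>e\<leftarrow>es. [:- e, 1:]) \<noteq> 0" by (auto simp: prod_list_zero_iff)
  then show ?case using Cons by (simp add: proots_mult del: mult_pCons_left)
qed simp

text \<open>The characteristic polynomial splits over the complex numbers, and the product of linear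
  factors does not depend on the order in which \<open>es\<close> lists the roots.\<close>

lemma char_poly_eq_linear_factors:
  fixes A :: "complex mat"
  assumes A: "A \<in> carrier_mat n n" and es: "proots (char_poly A) = mset es"
  shows "char_poly A = (\<Prod>e\<leftarrow>es. [:- e, 1:])" "length es = n"
proof -
  obtain fs where fs: "char_poly A = (\<Prod>e\<leftarrow>fs. [:- e, 1:])" "length fs = n"
    using char_poly_factorized[OF A] by blast
  then have m: "mset fs = mset es" using es proots_linear_factors by metis
  then have "(\<Prod>e\<leftarrow>fs. [:- e, 1:]) = (\<Prod>e\<leftarrow>es. [:- e, 1:])"
    by (metis mset_map prod_mset_prod_list)
  then show "char_poly A = (\<Prod>e\<leftarrow>es. [:- e, 1:])" using fs(1) by simp
  show "length es = n" using fs(2) mset_eq_length[OF m] by simp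
qed

text \<open>Conjugation preserves the characteristic polynomial. Conversely, one list
  \<open>es\<close> of the common eigenvalues diagonalises \<open>A\<close> and \<open>B\<close> to
  the same matrix, and the two conjugations compose.\<close>

lemma unitary_conj_iff_proots_eq:
  assumes A: "A \<in> carrier (unitary_group n)" and B: "B \<in> carrier (unitary_group n)"
  shows "(\<exists>W\<in>carrier (unitary_group n). B = W * A * mat_adjoint W) \<longleftrightarrow>
    proots (char_poly B) = proots (char_poly A)"
proof
  note Ad = unitary_groupD[OF A] and Bd = unitary_groupD[OF B]
  show "proots (char_poly B) = proots (char_poly A)"
    if "\<exists>W\<in>carrier (unitary_group n). B = W * A * mat_adjoint W"
    using that char_poly_unitary_conj[OF _ Ad(1)] by auto
  assume eq: "proots (char_poly B) = proots (char_poly A)"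
  obtain es where es: "proots (char_poly A) = mset es" by (metis ex_mset)
  obtain V where V: "V \<in> carrier (unitary_group n)" "A = V * mat_diag n ((!) es) * mat_adjoint V"
    using unitary_spectral[OF A char_poly_eq_linear_factors(1)[OF Ad(1) es]] by blast
  obtain W where W: "W \<in> carrier (unitary_group n)" "B = W * mat_diag n ((!) es) * mat_adjoint W"
    using unitary_spectral[OF B char_poly_eq_linear_factors(1)[OF Bd(1)]] es eq by metis
  have "mat_diag n ((!) es) = mat_adjoint V * A * V"
    unfolding V(2) using unitary_conj_inverse(2)[OF V(1)] by simp
  \<comment> \<open>Writing \<open>V\<close> as a double adjoint gives the shape that
    \<open>unitary_conj_conj\<close> expects; the conjugating matrix becomes
    \<open>W * mat_adjoint V\<close>.\<close>
  then have "mat_diag n ((!) es) = mat_adjoint V * A * mat_adjoint (mat_adjoint V)"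
    by (simp add: mat_adjoint_adjoint)
  then have "B = W * (mat_adjoint V * A * mat_adjoint (mat_adjoint V)) * mat_adjoint W"
    using W(2) by simp
  also have "\<dots> = (W * mat_adjoint V) * A * mat_adjoint (W * mat_adjoint V)"
    using unitary_groupD[OF W(1)] unitary_groupD[OF V(1)] Ad(1) by (intro unitary_conj_conj)
  finally show "\<exists>W\<in>carrier (unitary_group n). B = W * A * mat_adjoint W"
    using mult_unitary_group[OF W(1) mat_adjoint_unitary_group[OF V(1)]] by blast
qed

text \<open>Replaces orbits by fibres of the map from a unitary matrix to its eigenvalue multiset,
  which reduces the count of classes to a count of multisets.\<close>

lemma conjugacy_classes_unitary_group:
  "conjugacy_classes (unitary_group n) =
    (\<lambda>A. {B \<in> carrier (unitary_group n). proots (char_poly B) = proots (char_poly A)}) `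
      carrier (unitary_group n)"
proof -
  have "orbit (unitary_group n) (\<lambda>g. \<lambda>h\<in>carrier (unitary_group n).
      g \<otimes>\<^bsub>unitary_group n\<^esub> h \<otimes>\<^bsub>unitary_group n\<^esub> inv\<^bsub>unitary_group n\<^esub> g) A =
    {B \<in> carrier (unitary_group n). proots (char_poly B) = proots (char_poly A)}"
    if A: "A \<in> carrier (unitary_group n)" for A
  proof -
    have "orbit (unitary_group n) (\<lambda>g. \<lambda>h\<in>carrier (unitary_group n).
        g \<otimes>\<^bsub>unitary_group n\<^esub> h \<otimes>\<^bsub>unitary_group n\<^esub> inv\<^bsub>unitary_group n\<^esub> g) A =
      {B. \<exists>W\<in>carrier (unitary_group n). B = W * A * mat_adjoint W}"
    proof -
      have "g \<otimes>\<^bsub>unitary_group n\<^esub> A \<otimes>\<^bsub>unitary_group n\<^esub> inv\<^bsub>unitary_group n\<^esub> g = g * A * mat_adjoint g"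
        if "g \<in> carrier (unitary_group n)" for g
        using inv_unitary_group[OF that] by (simp add: unitary_group_def)
      then show ?thesis using A by (auto simp: orbit_def) metis
    qed
    also have "\<dots> = {B \<in> carrier (unitary_group n).
        \<exists>W\<in>carrier (unitary_group n). B = W * A * mat_adjoint W}"
      using A by (auto intro!: mult_unitary_group mat_adjoint_unitary_group)
    also have "\<dots> = {B \<in> carrier (unitary_group n). proots (char_poly B) = proots (char_poly A)}"
      using unitary_conj_iff_proots_eq[OF A] by blast
    finally show ?thesis .
  qed
  then show ?thesis unfolding conjugacy_classes_def orbits_def by blast
qed

section \<open>Spectrum, powers and torsion classes\<close>

lemma set_mset_proots_char_poly:
  fixes A :: "'a::field mat"
  assumes A: "A \<in> carrier_mat n n"
  shows "set_mset (proots (char_poly A)) = spectrum A"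
proof -
  have "char_poly A \<noteq> 0" using degree_monic_char_poly[OF A] by auto
  then show ?thesis by (simp add: spectrum_root_char_poly[OF A])
qed

lemma size_proots_char_poly:
  fixes A :: "complex mat"
  assumes "A \<in> carrier_mat n n"
  shows "size (proots (char_poly A)) = n"
  using degree_monic_char_poly[OF assms] by (simp add: size_proots_complex)

lemma mat_diag_pow: "mat_diag n f ^\<^sub>m k = mat_diag n (\<lambda>i. f i ^ k)"
  by (induction k) (simp_all add: power_commutes carrier_matD[OF mat_diag_dim])

text \<open>An eigenvector for \<open>e\<close> is one of the m-th power for \<open>e ^ m\<close>,
  which gives one direction. The other needs diagonalisability: the power is conjugate to the
  diagonal matrix of the \<open>e ^ m\<close>.\<close>

lemma unitary_pow_eq_one_iff:
  assumes A: "A \<in> carrier (unitary_group n)"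
  shows "A ^\<^sub>m m = 1\<^sub>m n \<longleftrightarrow> (\<forall>e\<in>spectrum A. e ^ m = 1)"
proof
  note Ad = unitary_groupD[OF A]
  assume eq: "A ^\<^sub>m m = 1\<^sub>m n"
  show "\<forall>e\<in>spectrum A. e ^ m = 1"
  proof
    fix e assume "e \<in> spectrum A"
    then obtain v where ev: "eigenvector A v e" by (auto simp: spectrum_def eigenvalue_def)
    then have v: "v \<in> carrier_vec n" "v \<noteq> 0\<^sub>v n" using Ad(1) by (auto simp: eigenvector_def)
    \<comment> \<open>A non-zero coordinate of \<open>v\<close> lets the scalar \<open>e ^ m\<close>
      be compared with 1.\<close>
    obtain i where i: "i < n" "v $ i \<noteq> 0" using v by (metis carrier_vecD eq_vecI index_zero_vec)
    have "v = e ^ m \<cdot>\<^sub>v v" using eigenvector_pow[OF Ad(1) ev, of m] eq v by simp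
    then have "v $ i = (e ^ m \<cdot>\<^sub>v v) $ i" by (rule arg_cong)
    then show "e ^ m = 1" using v(1) i by simp
  qed
next
  note Ad = unitary_groupD[OF A]
  assume roots: "\<forall>e\<in>spectrum A. e ^ m = 1"
  obtain es where es: "proots (char_poly A) = mset es" by (metis ex_mset)
  note cp = char_poly_eq_linear_factors[OF Ad(1) es]
  obtain W where W: "W \<in> carrier (unitary_group n)" "A = W * mat_diag n ((!) es) * mat_adjoint W"
    using unitary_spectral[OF A cp(1)] by blast
  have "set es = spectrum A" using set_mset_proots_char_poly[OF Ad(1)] es by simp
  then have "mat_diag n (\<lambda>i. es ! i ^ m) = mat_diag n (\<lambda>_. 1)"
    by (intro eq_matI) (use roots cp(2) in \<open>auto simp: mat_diag_def\<close>)
  moreover have "A ^\<^sub>m m = W * mat_diag n ((!) es) ^\<^sub>m m * mat_adjoint W"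
    unfolding W(2) by (rule similar_mat_wit_pow_id[OF similar_mat_wit_unitary[OF W(1) mat_diag_dim]])
  ultimately show "A ^\<^sub>m m = 1\<^sub>m n"
    using unitary_groupD[OF W(1)] by (simp add: mat_diag_pow)
qed

text \<open>A diagonal matrix with entries of modulus 1 is unitary. The lemma is used twice: to
  realise each admissible multiset by a class, and to see that distinct multisets give distinct
  classes.\<close>

lemma ex_unitary_proots_eq:
  assumes X: "size X = n" "\<And>e. e \<in># X \<Longrightarrow> cmod e = 1"
  shows "\<exists>A\<in>carrier (unitary_group n). proots (char_poly A) = X"
proof -
  obtain es where es: "X = mset es" by (metis ex_mset)
  have "mat_diag n ((!) es) \<in> carrier (unitary_group n)"
    using X es by (intro mat_diag_unitary_group) auto
  moreover have "proots (char_poly (mat_diag n ((!) es))) = X"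
    using char_poly_mat_diag[of es] X(1) es by (simp add: proots_linear_factors)
  ultimately show ?thesis by blast
qed

text \<open>Both torsion conditions can be read off the eigenvalue multiset, because its support is
  the spectrum. Each multiset of m-th roots of unity of size \<open>n\<close> does occur, since its
  elements have modulus 1.\<close>

lemma torsion_classes_unitary_group:
  assumes m: "m \<ge> 1"
  shows "torsion_classes (unitary_group n) m s =
    (\<lambda>X. {A \<in> carrier (unitary_group n). proots (char_poly A) = X}) `
      {X. size X = n \<and> set_mset X \<subseteq> {z. z ^ m = 1} \<and> card (set_mset X) = s}"
    (is "_ = ?g ` ?M")
proof -
  have tors: "x [^]\<^bsub>unitary_group n\<^esub> m = \<one>\<^bsub>unitary_group n\<^esub> \<and> card (spectrum x) = s \<longleftrightarrow>
      proots (char_poly x) \<in> ?M" if x: "x \<in> carrier (unitary_group n)" for x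
    using unitary_pow_eq_one_iff[OF x, of m] set_mset_proots_char_poly[OF unitary_groupD(1)[OF x]]
      size_proots_char_poly[OF unitary_groupD(1)[OF x]] pow_unitary_group[OF x, of m]
    by (auto simp: unitary_group_def)
  show ?thesis
  proof (intro equalityI subsetI)
    fix C assume C: "C \<in> torsion_classes (unitary_group n) m s"
    then obtain A where A: "A \<in> carrier (unitary_group n)" "C = ?g (proots (char_poly A))"
      by (auto simp: torsion_classes_def conjugacy_classes_unitary_group)
    then have "A \<in> C" by simp
    with C tors[OF A(1)] have "proots (char_poly A) \<in> ?M" by (auto simp: torsion_classes_def)
    with A(2) show "C \<in> ?g ` ?M" by blast
  next
    fix C assume "C \<in> ?g ` ?M"
    then obtain X where X: "X \<in> ?M" "C = ?g X" by blast
    \<comment> \<open>Here m \<ge> 1 matters: \<open>e ^ 0 = 1\<close> would say nothing about the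
      modulus of \<open>e\<close>.\<close>
    have "cmod e = 1" if "e \<in># X" for e
      using X(1) that m power_eq_1_iff[of e m] by auto
    then obtain A where A: "A \<in> carrier (unitary_group n)" "proots (char_poly A) = X"
      using X(1) ex_unitary_proots_eq[of X n] by auto
    have "C \<in> conjugacy_classes (unitary_group n)"
      unfolding conjugacy_classes_unitary_group X(2) using A by auto
    moreover have "\<forall>x\<in>C. x [^]\<^bsub>unitary_group n\<^esub> m = \<one>\<^bsub>unitary_group n\<^esub> \<and> card (spectrum x) = s"
      using X tors by auto
    ultimately show "C \<in> torsion_classes (unitary_group n) m s" by (simp add: torsion_classes_def)
  qed
qed

section \<open>Counting multisets by their support\<close>

lemma finite_multisets_of_size:
  assumes "finite R"
  shows "finite {X. size X = n \<and> set_mset X \<subseteq> R}"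
proof (rule finite_subset)
  show "{X. size X = n \<and> set_mset X \<subseteq> R} \<subseteq> mset ` {xs. set xs \<subseteq> R \<and> length xs = n}"
  proof
    fix X assume X: "X \<in> {X. size X = n \<and> set_mset X \<subseteq> R}"
    obtain xs where "mset xs = X" by (metis ex_mset)
    with X show "X \<in> mset ` {xs. set xs \<subseteq> R \<and> length xs = n}" by (auto intro!: image_eqI[of _ _ xs])
  qed
  show "finite (mset ` {xs. set xs \<subseteq> R \<and> length xs = n})"
    using finite_lists_length_eq[OF assms] by blast
qed

text \<open>The multiplicities form a composition of n + 1 into \<open>card S\<close> positive
  parts. For the induction, remove one copy of a fixed \<open>a\<close> in \<open>S\<close>: the
  support stays \<open>S\<close> or shrinks to \<open>S - {a}\<close>, and the two counts add up by
  Pascal's rule.\<close>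

lemma card_multisets_with_support:
  assumes "finite S" "S \<noteq> {}"
  shows "card {X. set_mset X = S \<and> size X = Suc n} = n choose (card S - 1)"
  using assms
proof (induction n arbitrary: S)
  case 0
  have single: "\<exists>x. X = {#x#}" if "size X = Suc 0" for X :: "'a multiset"
    using size_1_singleton_mset[of X] that by simp
  show ?case
  proof (cases "card S = 1")
    case True
    then obtain a where a: "S = {a}" by (auto simp: card_1_singleton_iff)
    have "{X. set_mset X = S \<and> size X = Suc 0} = {{#a#}}"
      using single unfolding a by (intro equalityI subsetI; clarsimp) fastforce
    with a show ?thesis by simp
  next
    case False
    have "set_mset X \<noteq> S" if "size X = Suc 0" for X
      using single[OF that] False by auto
    then have "{X. set_mset X = S \<and> size X = Suc 0} = {}" by blast
    \<comment> \<open>A support of at least two elements does not fit into a multiset of size 1, in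
      agreement with 0 choose a positive number being 0.\<close>
    moreover have "card S - 1 > 0" using False 0 card_gt_0_iff[of S] by linarith
    ultimately show ?thesis by (simp only: card.empty binomial_eq_0)
  qed
next
  case (Suc n)
  then obtain a where a: "a \<in> S" by blast
  define T where "T = S - {a}"
  have S: "S = insert a T" "a \<notin> T" "finite T" using a Suc.prems by (auto simp: T_def)
  let ?M = "\<lambda>S k. {X. set_mset X = S \<and> size X = k}"
  have fin: "finite (?M S' k)" if "finite S'" for S' k
    by (rule finite_subset[OF _ finite_multisets_of_size[OF that, of k]]) auto
  have split: "?M S (Suc (Suc n)) = add_mset a ` (?M S (Suc n) \<union> ?M T (Suc n))"
  proof (intro equalityI subsetI)
    fix X assume X: "X \<in> ?M S (Suc (Suc n))"
    then have "a \<in># X" using a by auto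
    then obtain Y where Y: "X = add_mset a Y" by (meson mset_add)
    with X S(1,2) have "Y \<in> ?M S (Suc n) \<union> ?M T (Suc n)"
      by (cases "a \<in># Y") auto
    with Y show "X \<in> add_mset a ` (?M S (Suc n) \<union> ?M T (Suc n))" by blast
  next
    fix X assume "X \<in> add_mset a ` (?M S (Suc n) \<union> ?M T (Suc n))"
    then obtain Y where "X = add_mset a Y" "size Y = Suc n" "set_mset Y = S \<or> set_mset Y = T"
      by blast
    then show "X \<in> ?M S (Suc (Suc n))" using insert_absorb[OF a] S(1) by auto
  qed
  \<comment> \<open>\<open>add_mset a\<close> is injective, and the two families are disjoint
    because \<open>a\<close> lies in \<open>S\<close> but not in \<open>T\<close>.\<close>
  have "card (?M S (Suc (Suc n))) = card (?M S (Suc n) \<union> ?M T (Suc n))"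
    unfolding split by (rule card_image) (simp add: inj_on_def)
  also have "\<dots> = card (?M S (Suc n)) + card (?M T (Suc n))"
    using a S(2) by (intro card_Un_disjoint fin Suc.prems(1) S(3)) blast
  also have "card (?M S (Suc n)) = n choose (card T)"
    using Suc.IH[OF Suc.prems] S by simp
  also have "(n choose card T) + card (?M T (Suc n)) = Suc n choose (card S - 1)"
  \<comment> \<open>The induction hypothesis covers only non-empty supports. For empty
    \<open>T\<close> no multiset of positive size remains, and both sides equal 1.\<close>
  proof (cases "T = {}")
    case False
    then have "card T = Suc (card T - 1)" using S(3) by (simp add: card_gt_0_iff)
    then show ?thesis
      using Suc.IH[OF S(3) False] S by (metis binomial_Suc_Suc add.commute card_insert_disjoint diff_Suc_1)
  qed (use S in auto)
  finally show ?case .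
qed

text \<open>Partition by support: there are \<open>card R choose s\<close> possible supports, each
  non-empty because s \<ge> 1, and all carry the same number of multisets.\<close>

lemma card_multisets_with_support_card:
  assumes R: "finite R" and n: "n \<ge> 1" and s: "s \<ge> 1"
  shows "card {X. size X = n \<and> set_mset X \<subseteq> R \<and> card (set_mset X) = s} =
    ((n - 1) choose (s - 1)) * (card R choose s)"
proof -
  let ?I = "{S. S \<subseteq> R \<and> card S = s}"
  have fin: "finite S" if "S \<in> ?I" for S using that R finite_subset by auto
  have "card {X. size X = n \<and> set_mset X \<subseteq> R \<and> card (set_mset X) = s} =
    card (\<Union>S\<in>?I. {X. set_mset X = S \<and> size X = n})"
    by (rule arg_cong[where f = card]) auto
  also have "\<dots> = (\<Sum>S\<in>?I. card {X. set_mset X = S \<and> size X = n})"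
  proof (rule card_UN_disjoint)
    show "\<forall>S\<in>?I. finite {X. set_mset X = S \<and> size X = n}"
    proof
      fix S assume "S \<in> ?I"
      from finite_multisets_of_size[OF fin[OF this], of n]
      show "finite {X. set_mset X = S \<and> size X = n}" by (rule rev_finite_subset) auto
    qed
  qed (use R in auto)
  also have "\<dots> = (\<Sum>S\<in>?I. (n - 1) choose (s - 1))"
  proof (rule sum.cong)
    fix S assume S: "S \<in> ?I"
    then have "S \<noteq> {}" using s by auto
    \<comment> \<open>The instance is n - 1 because the lemma counts multisets of size
      \<open>Suc n\<close>.\<close>
    from card_multisets_with_support[OF fin[OF S] this, of "n - 1"] S n
    show "card {X. set_mset X = S \<and> size X = n} = (n - 1) choose (s - 1)" by simp
  qed simp
  also have "\<dots> = ((n - 1) choose (s - 1)) * (card R choose s)"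
    using n_subsets[OF R] by simp
  finally show ?thesis .
qed

section \<open>The number of torsion classes\<close>

theorem theorem3:
  fixes n m s :: nat
  assumes "n \<ge> 1" and "m \<ge> 1" and "s \<ge> 1"
  shows "finite (torsion_classes (unitary_group n) m s) \<and>
    N (unitary_group n) m s = ((n - 1) choose (s - 1)) * (m choose s) \<and>
    real (((n - 1) choose (s - 1)) * (m choose s)) =
      real s / real n * real (n choose s) * real (m choose s)"
proof (intro conjI)
  define R where "R = {z :: complex. z ^ m = 1}"
  define M where "M = {X. size X = n \<and> set_mset X \<subseteq> R \<and> card (set_mset X) = s}"
  define g where "g X = {A \<in> carrier (unitary_group n). proots (char_poly A) = X}" for X
  have R: "finite R" "card R = m"
    unfolding R_def using assms by (auto intro: finite_roots_unity card_roots_unity_eq)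
  have T: "torsion_classes (unitary_group n) m s = g ` M"
    unfolding torsion_classes_unitary_group[OF assms(2)] g_def M_def R_def ..
  have "finite M"
    by (rule finite_subset[OF _ finite_multisets_of_size[OF R(1), of n]]) (auto simp: M_def)
  then show "finite (torsion_classes (unitary_group n) m s)" unfolding T by simp
  \<comment> \<open>Each \<open>g X\<close> with \<open>X\<close> in \<open>M\<close> is non-empty,
    and any member of it recovers \<open>X\<close> as its eigenvalue multiset.\<close>
  have "inj_on g M"
  proof (rule inj_onI)
    fix X Y assume X: "X \<in> M" and eq: "g X = g Y"
    have "cmod e = 1" if "e \<in># X" for e
      using X that assms(2) power_eq_1_iff[of e m] by (auto simp: M_def R_def)
    then obtain A where "A \<in> g X"
      using X ex_unitary_proots_eq[of X n] by (auto simp: g_def M_def)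
    with eq show "X = Y" by (auto simp: g_def)
  qed
  then have "card (g ` M) = card M" by (rule card_image)
  then show "N (unitary_group n) m s = ((n - 1) choose (s - 1)) * (m choose s)"
    unfolding N_def T using card_multisets_with_support_card[OF R(1) assms(1,3)] R(2)
    by (simp add: M_def)
  \<comment> \<open>The absorption identity for binomial coefficients; division by \<open>n\<close>
    turns it into the second closed form.\<close>
  have "real s * real (n choose s) = real n * real ((n - 1) choose (s - 1))"
    unfolding of_nat_mult[symmetric] using times_binomial_minus1_eq[of s n] assms(3) by simp
  then show "real (((n - 1) choose (s - 1)) * (m choose s)) =
      real s / real n * real (n choose s) * real (m choose s)"
    using assms(1) by (simp add: field_simps)
qed

end
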